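(* Let the initial universe set $X$ and the parameter set $E$ both be binary sets (i.e. each has exactly two elements). Then every soft $T_2$-II space $(X,\mathcal{T},E)$ over $X$ is a soft $T_2$-I space.
   Context: Let $X$ be a universe set and $E$ a set of parameters. A soft set $(F,E)$ over $X$ is a mapping $F:E\to\mathcal{P}(X)$. Unions and intersections of soft sets are taken parameterwise: $(F\cup G)(e)=F(e)\cup G(e)$, $(F\cap G)(e)=F(e)\cap G(e)$, and similarly for arbitrary families. $\widetilde{\emptyset}$ and $\widetilde{X}$ denote the soft sets with constant value $\emptyset$ and $X$, respectively. A soft topology on $X$ (with parameter set $E$) is a collection $\mathcal{T}$ of soft sets $(F,E)$ over $X$ which contains $\widetilde{\emptyset}$ and $\widetilde{X}$ and is closed under arbitrary unions and under intersections of two members; $(X,\mathcal{T},E)$ is then called a soft topological space, and members of $\mathcal{T}$ are called soft open sets. For $x\in X$, write $x\,\widehat{\in}\,(F,E)$ if $x\in F(e)$ for all $e\in E$. For $a\in E$ and $x\in X$, the soft point $P_a^x$ is the soft set with value $\{x\}$ at $a$ and value $\emptyset$ at every other parameter. Write $P_a^x\,\widetilde{\in}\,(F,E)$ if $x\in F(a)$. Two soft points $P_a^x$, $P_b^y$ are different iff $(a,x)\neq(b,y)$. $(X,\mathcal{T},E)$ is a soft $T_2$-I space if for all $x,y\in X$ with $x\neq y$ there are soft open sets $(F,E)$ and $(G,E)$ with $x\,\widehat{\in}\,(F,E)$, $y\,\widehat{\in}\,(G,E)$ and $(F,E)\cap(G,E)=\widetilde{\emptyset}$. $(X,\mathcal{T},E)$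 is a soft $T_2$-II space if for all soft points $P_a^x\neq P_b^y$ there are soft open sets $(F,E)$ and $(G,E)$ with $P_a^x\,\widetilde{\in}\,(F,E)$, $P_b^y\,\widetilde{\in}\,(G,E)$ and $(F,E)\cap(G,E)=\widetilde{\emptyset}$. *)

theory Defs
  imports Main "HOL-Library.FuncSet"
begin

text \<open>
  A soft set over \<open>X\<close> with parameter set \<open>E\<close> is a map \<open>E \<rightarrow> Pow X\<close>. It is represented by an
  extensional function (value \<open>undefined\<close> outside \<open>E\<close>), so that HOL equality of soft sets is
  parameterwise equality on \<open>E\<close>; the operations below therefore restrict their results to \<open>E\<close>.
\<close>

definition soft_sets :: "'x set \<Rightarrow> 'e set \<Rightarrow> ('e \<Rightarrow> 'x set) set" where
  "soft_sets X E = (E \<rightarrow>\<^sub>E Pow X)"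

definition soft_null :: "'e set \<Rightarrow> 'e \<Rightarrow> 'x set" where
  "soft_null E = (\<lambda>e\<in>E. {})"

definition soft_absolute :: "'x set \<Rightarrow> 'e set \<Rightarrow> 'e \<Rightarrow> 'x set" where
  "soft_absolute X E = (\<lambda>e\<in>E. X)"

definition soft_Union :: "'e set \<Rightarrow> ('e \<Rightarrow> 'x set) set \<Rightarrow> 'e \<Rightarrow> 'x set" where
  "soft_Union E \<F> = (\<lambda>e\<in>E. \<Union>F\<in>\<F>. F e)"

definition soft_inter :: "'e set \<Rightarrow> ('e \<Rightarrow> 'x set) \<Rightarrow> ('e \<Rightarrow> 'x set) \<Rightarrow> 'e \<Rightarrow> 'x set" where
  "soft_inter E F G = (\<lambda>e\<in>E. F e \<inter> G e)"

definition soft_topological_space :: "'x set \<Rightarrow> ('e \<Rightarrow> 'x set) set \<Rightarrow> 'e set \<Rightarrow> bool" where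
  "soft_topological_space X T E \<longleftrightarrow>
     T \<subseteq> soft_sets X E \<and>
     soft_null E \<in> T \<and>
     soft_absolute X E \<in> T \<and>
     (\<forall>\<F>. \<F> \<subseteq> T \<longrightarrow> soft_Union E \<F> \<in> T) \<and>
     (\<forall>F\<in>T. \<forall>G\<in>T. soft_inter E F G \<in> T)"

definition soft_elem :: "'e set \<Rightarrow> 'x \<Rightarrow> ('e \<Rightarrow> 'x set) \<Rightarrow> bool" where
  "soft_elem E x F \<longleftrightarrow> (\<forall>e\<in>E. x \<in> F e)"

definition soft_point :: "'e set \<Rightarrow> 'e \<Rightarrow> 'x \<Rightarrow> 'e \<Rightarrow> 'x set" where
  "soft_point E a x = (\<lambda>e\<in>E. if e = a then {x} else {})"

text \<open>Membership of the soft point \<open>soft_point E a x\<close> in a soft set, in terms of its data \<open>a\<close>, \<open>x\<close>.\<close>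

definition soft_point_elem :: "'e \<Rightarrow> 'x \<Rightarrow> ('e \<Rightarrow> 'x set) \<Rightarrow> bool" where
  "soft_point_elem a x F \<longleftrightarrow> x \<in> F a"

lemma soft_point_eq_iff:
  assumes "a \<in> E" "b \<in> E"
  shows "soft_point E a x = soft_point E b y \<longleftrightarrow> (a, x) = (b, y)"
proof
  assume "soft_point E a x = soft_point E b y"
  then have "soft_point E a x a = soft_point E b y a" by simp
  with assms show "(a, x) = (b, y)"
    by (simp add: soft_point_def split: if_splits)
qed simp

definition soft_T2_I_space :: "'x set \<Rightarrow> ('e \<Rightarrow> 'x set) set \<Rightarrow> 'e set \<Rightarrow> bool" where
  "soft_T2_I_space X T E \<longleftrightarrow>
     soft_topological_space X T E \<and>
     (\<forall>x\<in>X. \<forall>y\<in>X. x \<noteq> y \<longrightarrow>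
        (\<exists>F\<in>T. \<exists>G\<in>T. soft_elem E x F \<and> soft_elem E y G \<and> soft_inter E F G = soft_null E))"

definition soft_T2_II_space :: "'x set \<Rightarrow> ('e \<Rightarrow> 'x set) set \<Rightarrow> 'e set \<Rightarrow> bool" where
  "soft_T2_II_space X T E \<longleftrightarrow>
     soft_topological_space X T E \<and>
     (\<forall>a\<in>E. \<forall>b\<in>E. \<forall>x\<in>X. \<forall>y\<in>X. soft_point E a x \<noteq> soft_point E b y \<longrightarrow>
        (\<exists>F\<in>T. \<exists>G\<in>T. soft_point_elem a x F \<and> soft_point_elem b y G \<and>
           soft_inter E F G = soft_null E))"

end

theory Submission imports Defs begin

text \<open>
  A soft topology is an ordinary topology on the set \<open>E \<times> X\<close> of soft points, and soft \<open>T\<^sub>2\<close>-II is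
  its Hausdorff property. A finite Hausdorff space is discrete, so the soft set with constant value
  \<open>{x}\<close> is open for every \<open>x\<close>, and these soft sets are pairwise disjoint.
\<close>

text \<open>Induction on \<open>S\<close>: separating \<open>(a, x)\<close> from a newly added point
  gives an open \<open>G\<close> that misses this point, and intersecting \<open>G\<close> with the
  open set obtained for the rest keeps \<open>x\<close> at \<open>a\<close>. Finiteness of
  \<open>S\<close> matters because only finite intersections of open sets are known to be
  open.\<close>

lemma soft_T2_II_avoid_finite:
  assumes T2: "soft_T2_II_space X T E" and a: "a \<in> E" and x: "x \<in> X"
    and "finite S" and "S \<subseteq> E \<times> X - {(a, x)}"
  shows "\<exists>F\<in>T. x \<in> F a \<and> (\<forall>(b, y)\<in>S. y \<notin> F b)"
  using assms(4,5)
proof (induction S rule: finite_induct)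
  case empty
  have "soft_absolute X E \<in> T"
    using T2 by (simp add: soft_T2_II_space_def soft_topological_space_def)
  then show ?case using a x by (intro bexI[of _ "soft_absolute X E"]) (auto simp: soft_absolute_def)
next
  case (insert p S)
  obtain b y where p: "p = (b, y)" by (cases p)
  with insert.prems have b: "b \<in> E" and y: "y \<in> X" and ne: "(a, x) \<noteq> (b, y)" by auto
  from insert obtain F where F: "F \<in> T" "x \<in> F a" "\<forall>(b, y)\<in>S. y \<notin> F b" by auto
  \<comment> \<open>Distinct pairs give distinct soft points because both parameters lie in
    \<open>E\<close>.\<close>
  have "soft_point E a x \<noteq> soft_point E b y"
    using ne soft_point_eq_iff[OF a b] by metis
  then obtain G H where G: "G \<in> T" "x \<in> G a" and H: "y \<in> H b" and "soft_inter E G H = soft_null E"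
    using T2 a b x y unfolding soft_T2_II_space_def soft_point_elem_def by metis
  \<comment> \<open>Only the parameter \<open>b\<close> matters: \<open>G b\<close> and
    \<open>H b\<close> are disjoint and \<open>y\<close> lies in \<open>H b\<close>.\<close>
  then have "soft_inter E G H b = soft_null E b" by simp
  with H b have "y \<notin> G b" by (auto simp: soft_inter_def soft_null_def)
  moreover have "soft_inter E F G \<in> T"
    using T2 F G by (simp add: soft_T2_II_space_def soft_topological_space_def)
  ultimately show ?case
    using F G a b p insert.prems
    by (intro bexI[of _ "soft_inter E F G"]) (auto simp: soft_inter_def split: if_splits)
qed

text \<open>All soft points other than \<open>(a, x)\<close> form a finite set, and an open soft set
  that avoids all of them while containing \<open>(a, x)\<close> must be the soft point
  itself.\<close>

lemma soft_T2_II_finite_soft_point_open: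
  assumes T2: "soft_T2_II_space X T E" and "finite X" "finite E" and a: "a \<in> E" and x: "x \<in> X"
  shows "soft_point E a x \<in> T"
proof -
  obtain F where F: "F \<in> T" "x \<in> F a" "\<forall>(b, y)\<in>E \<times> X - {(a, x)}. y \<notin> F b"
    using soft_T2_II_avoid_finite[OF T2 a x, of "E \<times> X - {(a, x)}"] assms(2,3) by auto
  have FE: "F \<in> E \<rightarrow>\<^sub>E Pow X"
    using T2 F(1) by (auto simp: soft_T2_II_space_def soft_topological_space_def soft_sets_def)
  have "F e = soft_point E a x e" for e
  proof (cases "e \<in> E")
    case True
    with FE have "F e \<subseteq> X" by auto
    with True F(2,3) show ?thesis by (auto simp: soft_point_def)
  next
    \<comment> \<open>Outside \<open>E\<close> both functions take the value
      \<open>undefined\<close>.\<close>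
    case False
    with FE show ?thesis by (auto simp: soft_point_def)
  qed
  then have "F = soft_point E a x" ..
  with F(1) show ?thesis by simp
qed

lemma finite_soft_T2_II_imp_soft_T2_I:
  assumes "finite X" "finite E" and T2: "soft_T2_II_space X T E"
  shows "soft_T2_I_space X T E"
proof -
  have top: "soft_topological_space X T E" using T2 by (simp add: soft_T2_II_space_def)
  have const_open: "(\<lambda>e\<in>E. {x}) \<in> T" if x: "x \<in> X" for x
  proof -
    \<comment> \<open>The constant soft set is the union, over all parameters, of the soft points at
      \<open>x\<close>.\<close>
    have "(\<lambda>a. soft_point E a x) ` E \<subseteq> T"
      using soft_T2_II_finite_soft_point_open[OF T2 assms(1,2) _ x] by auto
    then have "soft_Union E ((\<lambda>a. soft_point E a x) ` E) \<in> T"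
      using top by (simp add: soft_topological_space_def)
    also have "soft_Union E ((\<lambda>a. soft_point E a x) ` E) = (\<lambda>e\<in>E. {x})"
      by (auto simp: soft_Union_def soft_point_def fun_eq_iff restrict_def)
    finally show ?thesis .
  qed
  have "\<exists>F\<in>T. \<exists>G\<in>T. soft_elem E x F \<and> soft_elem E y G \<and> soft_inter E F G = soft_null E"
    if "x \<in> X" "y \<in> X" "x \<noteq> y" for x y
  proof (intro bexI conjI)
    \<comment> \<open>These goals fix the witnesses \<open>F\<close> and \<open>G\<close>, left
      schematic so far, as the constant soft sets.\<close>
    show "soft_elem E x (\<lambda>e\<in>E. {x})" "soft_elem E y (\<lambda>e\<in>E. {y})"
      by (auto simp: soft_elem_def)
    show "soft_inter E (\<lambda>e\<in>E. {x}) (\<lambda>e\<in>E. {y}) = soft_null E"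
      using that(3) by (auto simp: soft_inter_def soft_null_def fun_eq_iff restrict_def)
  qed (use that const_open in auto)
  with top show ?thesis by (auto simp: soft_T2_I_space_def)
qed

theorem proposition3p6:
  fixes X :: "'x set" and E :: "'e set" and T :: "('e \<Rightarrow> 'x set) set"
  assumes "card X = 2" and "card E = 2"
    and "soft_T2_II_space X T E"
  shows "soft_T2_I_space X T E"
proof (rule finite_soft_T2_II_imp_soft_T2_I)
  show "finite X" "finite E"
    \<comment> \<open>Since \<open>card\<close> is 0 on infinite sets, a positive cardinality forces
      finiteness.\<close>
    using assms(1,2) by (auto intro: card_ge_0_finite)
qed (fact assms(3))

end
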